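(* For any treatment $g$, the weighted average treatment effect decomposes as $$\mathbb{E}[\gamma_g(\mathbf{X})\tau_g(\mathbf{X})] = \mathbb{E}[\tau_g(\mathbf{X})] + \mathrm{Cov}(\tau_g(\mathbf{X}), \gamma_g(\mathbf{X})),$$ i.e. $\mathrm{WATE}_g = \mathrm{ATE}_g + \mathrm{Cov}(\tau_g(\mathbf{X}), \gamma_g(\mathbf{X}))$.
   Context: Let $\mathbf{X}$ be a random covariate vector in $\mathbb{R}^d$. For each treatment $g$, let $W_g \in \{0,1\}$ be the binary random variable indicating receipt of treatment $g$, with propensity score $p_g(\mathbf{X}) = \mathbb{E}[W_g \mid \mathbf{X}]$, so that $\mathbb{V}[W_g \mid \mathbf{X}] = p_g(\mathbf{X})(1-p_g(\mathbf{X}))$. Let $\tau_g(\mathbf{X}) = \mathbb{E}[Y(g) - Y(0) \mid \mathbf{X}]$ be the real-valued conditional average treatment effect of $g$ relative to control, where $Y(g), Y(0)$ are the potential outcomes. Assume $\tau_g(\mathbf{X})$ is integrable and $\mathbb{E}[p_g(\mathbf{X})(1-p_g(\mathbf{X}))] > 0$. The normalized regression weights are $$\gamma_g(\mathbf{X}) = \frac{\mathbb{V}[W_g \mid \mathbf{X}]}{\mathbb{E}[\mathbb{V}[W_g \mid \mathbf{X}]]} = \frac{p_g(\mathbf{X})(1-p_g(\mathbf{X}))}{\mathbb{E}[p_g(\mathbf{X})(1-p_g(\mathbf{X}))]}.$$ Define $\mathrm{ATE}_g = \mathbb{E}[\tau_g(\mathbf{X})]$ and $\mathrm{WATE}_g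 = \mathbb{E}[\gamma_g(\mathbf{X})\tau_g(\mathbf{X})]$, and $\mathrm{Cov}(A,B) = \mathbb{E}[AB] - \mathbb{E}[A]\mathbb{E}[B]$. *)

theory Defs
  imports "HOL-Probability.Probability"
begin

definition sigma_of :: "'w measure \<Rightarrow> ('w \<Rightarrow> 'x::topological_space) \<Rightarrow> 'w measure" where
  "sigma_of M X = vimage_algebra (space M) X borel"

text \<open>
  \<open>cond_exp_given M X Z\<close> is \<open>E[Z | X]\<close> and \<open>cond_var_given M X Z\<close> is \<open>V[Z | X]\<close>, both as
  random variables on \<open>M\<close> (one fixed version each).
\<close>

definition cond_exp_given ::
    "'w measure \<Rightarrow> ('w \<Rightarrow> 'x::topological_space) \<Rightarrow> ('w \<Rightarrow> real) \<Rightarrow> 'w \<Rightarrow> real" where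
  "cond_exp_given M X Z = real_cond_exp M (sigma_of M X) Z"

definition cond_var_given ::
    "'w measure \<Rightarrow> ('w \<Rightarrow> 'x::topological_space) \<Rightarrow> ('w \<Rightarrow> real) \<Rightarrow> 'w \<Rightarrow> real" where
  "cond_var_given M X Z =
     cond_exp_given M X (\<lambda>\<omega>. (Z \<omega> - cond_exp_given M X Z \<omega>)\<^sup>2)"

text \<open>
  \<open>is_regression_function M X Z f\<close> says that \<open>f\<close> is a real-valued version of
  \<open>x \<mapsto> E[Z | X = x]\<close>.  The variable \<open>Z\<close> need not be integrable: the second conjunct,
  \<open>E[|Z| | X] < \<infinity>\<close> almost surely, is exactly what makes \<open>E[Z | X]\<close> exist as a real number
  almost surely (\<^const>\<open>real_cond_exp\<close> has a default value otherwise).  It holds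
  automatically when \<open>Z\<close> is integrable.
\<close>

definition is_regression_function ::
    "'w measure \<Rightarrow> ('w \<Rightarrow> 'x::topological_space) \<Rightarrow> ('w \<Rightarrow> real) \<Rightarrow> ('x \<Rightarrow> real) \<Rightarrow> bool" where
  "is_regression_function M X Z f \<longleftrightarrow>
     f \<in> borel_measurable borel \<and>
     (AE \<omega> in M. nn_cond_exp M (sigma_of M X) (\<lambda>\<omega>. ennreal \<bar>Z \<omega>\<bar>) \<omega> < \<infinity>) \<and>
     (AE \<omega> in M. f (X \<omega>) = cond_exp_given M X Z \<omega>)"

definition covariance :: "'w measure \<Rightarrow> ('w \<Rightarrow> real) \<Rightarrow> ('w \<Rightarrow> real) \<Rightarrow> real" where
  "covariance M A B =
     (\<integral>\<omega>. A \<omega> * B \<omega> \<partial>M) - (\<integral>\<omega>. A \<omega> \<partial>M) * (\<integral>\<omega>. B \<omega> \<partial>M)"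

text \<open>
  \<open>G\<close> is the set of treatments and \<open>c\<close> the control arm.  No relation between the indicators
  \<open>W g\<close> of different treatments is imposed.
\<close>

locale treatment_model = prob_space M
  for M :: "'w measure" +
  fixes X :: "'w \<Rightarrow> real ^ 'd"
    and G :: "'g set" and c :: 'g
    and W :: "'g \<Rightarrow> 'w \<Rightarrow> real"
    and Y :: "'g \<Rightarrow> 'w \<Rightarrow> real"
    and p :: "'g \<Rightarrow> real ^ 'd \<Rightarrow> real"
    and \<tau> :: "'g \<Rightarrow> real ^ 'd \<Rightarrow> real"
  assumes covariate [measurable]: "random_variable borel X"
    and control_not_treatment: "c \<notin> G"
    and control_outcome: "random_variable borel (Y c)"
    and treated_outcome: "g \<in> G \<Longrightarrow> random_variable borel (Y g)"
    and treatment: "g \<in> G \<Longrightarrow> random_variable borel (W g)"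
    and treatment_binary: "g \<in> G \<Longrightarrow> \<omega> \<in> space M \<Longrightarrow> W g \<omega> \<in> {0, 1}"
    and propensity: "g \<in> G \<Longrightarrow> is_regression_function M X (W g) (p g)"
    and cate: "g \<in> G \<Longrightarrow> is_regression_function M X (\<lambda>\<omega>. Y g \<omega> - Y c \<omega>) (\<tau> g)"
    and cate_integrable: "g \<in> G \<Longrightarrow> integrable M (\<lambda>\<omega>. \<tau> g (X \<omega>))"
    and overlap: "g \<in> G \<Longrightarrow> 0 < (\<integral>\<omega>. p g (X \<omega>) * (1 - p g (X \<omega>)) \<partial>M)"

text \<open>The normalized regression weight \<open>\<gamma>\<^sub>g(X)\<close>, as a random variable, for \<open>Z = W\<^sub>g\<close>.\<close>

definition regression_weight ::
    "'w measure \<Rightarrow> ('w \<Rightarrow> 'x::topological_space) \<Rightarrow> ('w \<Rightarrow> real) \<Rightarrow> 'w \<Rightarrow> real" where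
  "regression_weight M X Z \<omega> =
     cond_var_given M X Z \<omega> / (\<integral>\<omega>'. cond_var_given M X Z \<omega>' \<partial>M)"

definition ATE :: "'w measure \<Rightarrow> ('w \<Rightarrow> 'x) \<Rightarrow> ('x \<Rightarrow> real) \<Rightarrow> real" where
  "ATE M X t = (\<integral>\<omega>. t (X \<omega>) \<partial>M)"

definition WATE ::
    "'w measure \<Rightarrow> ('w \<Rightarrow> 'x::topological_space) \<Rightarrow> ('w \<Rightarrow> real) \<Rightarrow> ('x \<Rightarrow> real) \<Rightarrow> real" where
  "WATE M X Z t = (\<integral>\<omega>. regression_weight M X Z \<omega> * t (X \<omega>) \<partial>M)"

end

theory Submission
  imports Defs
begin

text \<open>
  Since \<open>Cov(\<tau>, \<gamma>) = E[\<gamma>\<tau>] - E[\<tau>]E[\<gamma>]\<close>, only \<open>E[\<gamma>] = 1\<close> is at stake, that is, that the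
  normalizing constant \<open>E[V[W | X]]\<close> does not vanish.  For binary \<open>W\<close> with \<open>m = E[W | X]\<close>,
  expanding \<open>(W - m)\<^sup>2 = W - 2mW + m\<^sup>2\<close> and using \<open>E[mW] = E[m\<^sup>2]\<close> identifies it with
  \<open>E[m(1 - m)]\<close>, which is positive by overlap.
\<close>

text \<open>A finite measure stays finite, hence sigma-finite, on any subalgebra; this gives access
  to the theory of \<open>real_cond_exp\<close>.\<close>

lemma (in prob_space) sigma_finite_subalgebra_sigma_of:
  assumes "random_variable borel X"
  shows "sigma_finite_subalgebra M (sigma_of M X)"
proof -
  have "subalgebra M (sigma_of M X)"
    using assms by (auto simp: subalgebra_def sigma_of_def sets_vimage_algebra2 measurable_sets)
  then show ?thesis
    by (intro finite_measure_subalgebra_is_sigma_finite finite_measure_subalgebra.intro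
        finite_measure_axioms finite_measure_subalgebra_axioms.intro)
qed

lemma (in prob_space) integral_cond_var_given_binary:
  assumes X: "random_variable borel X"
    and Z [measurable]: "random_variable borel Z"
    and binary: "\<And>\<omega>. \<omega> \<in> space M \<Longrightarrow> Z \<omega> \<in> {0, 1}"
  shows "(\<integral>\<omega>. cond_var_given M X Z \<omega> \<partial>M) =
    (\<integral>\<omega>. cond_exp_given M X Z \<omega> * (1 - cond_exp_given M X Z \<omega>) \<partial>M)"
proof -
  interpret S: sigma_finite_subalgebra M "sigma_of M X"
    by (rule sigma_finite_subalgebra_sigma_of[OF X])
  let ?m = "real_cond_exp M (sigma_of M X) Z"
  have m_sub: "?m \<in> borel_measurable (sigma_of M X)" and [measurable]: "?m \<in> borel_measurable M"
    by simp_all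
  have Z_int: "integrable M Z"
    by (rule integrable_const_bound[where B = 1]) (use binary in force)+
  \<comment> \<open>Conditional expectation preserves the bounds 0 and 1 of \<open>Z\<close>, though
    only almost everywhere; this makes \<open>?m * Z\<close> bounded and so integrable.\<close>
  have "AE \<omega> in M. 0 \<le> ?m \<omega>" "AE \<omega> in M. ?m \<omega> \<le> 1"
    by (rule S.real_cond_exp_ge_c[OF Z_int] S.real_cond_exp_le_c[OF Z_int], use binary in force)+
  then have m_bound: "AE \<omega> in M. \<bar>?m \<omega>\<bar> \<le> 1"
    by eventually_elim simp
  have Zm_int: "integrable M (\<lambda>\<omega>. ?m \<omega> * Z \<omega>)"
  proof (rule integrable_const_bound[where B = 1])
    show "AE \<omega> in M. norm (?m \<omega> * Z \<omega>) \<le> 1"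
      using m_bound AE_space by eventually_elim (use binary in force)
  qed simp
  \<comment> \<open>The characteristic property of E[Z | X], tested against \<open>?m\<close>
    itself, which is measurable with respect to \<open>sigma_of M X\<close>.\<close>
  have mm_int: "integrable M (\<lambda>\<omega>. ?m \<omega> * ?m \<omega>)"
    and Zm: "(\<integral>\<omega>. ?m \<omega> * ?m \<omega> \<partial>M) = (\<integral>\<omega>. ?m \<omega> * Z \<omega> \<partial>M)"
    using S.real_cond_exp_intg[OF Zm_int m_sub] Z by auto
  have m_int: "integrable M ?m" and Em: "integral\<^sup>L M ?m = integral\<^sup>L M Z"
    using S.real_cond_exp_int[OF Z_int] by auto
  \<comment> \<open>Binarity enters as \<open>Z * Z = Z\<close>, which is available only on
    \<open>space M\<close>.\<close>
  have expand: "(Z \<omega> - ?m \<omega>)\<^sup>2 = Z \<omega> - 2 * (?m \<omega> * Z \<omega>) + ?m \<omega> * ?m \<omega>"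
    if "\<omega> \<in> space M" for \<omega>
    using binary[OF that] by (auto simp: power2_eq_square algebra_simps)
  have expansion_int: "integrable M (\<lambda>\<omega>. Z \<omega> - 2 * (?m \<omega> * Z \<omega>) + ?m \<omega> * ?m \<omega>)"
    using Z_int Zm_int mm_int by simp
  then have "integrable M (\<lambda>\<omega>. (Z \<omega> - ?m \<omega>)\<^sup>2)"
    by (rule Bochner_Integration.integrable_cong[OF refl expand, THEN iffD2, rotated])
  \<comment> \<open>Tower property: integrating removes the outer conditional expectation.\<close>
  then have "(\<integral>\<omega>. cond_var_given M X Z \<omega> \<partial>M) = (\<integral>\<omega>. (Z \<omega> - ?m \<omega>)\<^sup>2 \<partial>M)"
    unfolding cond_var_given_def cond_exp_given_def by (rule S.real_cond_exp_int)
  also have "\<dots> = (\<integral>\<omega>. Z \<omega> - 2 * (?m \<omega> * Z \<omega>) + ?m \<omega> * ?m \<omega> \<partial>M)"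
    by (simp add: expand cong: Bochner_Integration.integral_cong)
  also have "\<dots> = integral\<^sup>L M Z - 2 * (\<integral>\<omega>. ?m \<omega> * Z \<omega> \<partial>M) + (\<integral>\<omega>. ?m \<omega> * ?m \<omega> \<partial>M)"
    using Z_int Zm_int mm_int by simp
  also have "\<dots> = (\<integral>\<omega>. ?m \<omega> * (1 - ?m \<omega>) \<partial>M)"
    using m_int mm_int Zm Em by (simp add: right_diff_distrib)
  finally show ?thesis
    unfolding cond_exp_given_def .
qed

lemma (in treatment_model) integral_regression_weight:
  assumes "g \<in> G"
  shows "(\<integral>\<omega>. regression_weight M X (W g) \<omega> \<partial>M) = 1"
proof -
  have p_eq: "AE \<omega> in M. p g (X \<omega>) = cond_exp_given M X (W g) \<omega>"
    and p_meas [measurable]: "p g \<in> borel_measurable borel"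
    using propensity[OF assms] by (auto simp: is_regression_function_def)
  have [measurable]: "cond_exp_given M X (W g) \<in> borel_measurable M"
    by (simp add: cond_exp_given_def)
  have "(\<integral>\<omega>. cond_var_given M X (W g) \<omega> \<partial>M) =
      (\<integral>\<omega>. cond_exp_given M X (W g) \<omega> * (1 - cond_exp_given M X (W g) \<omega>) \<partial>M)"
    by (rule integral_cond_var_given_binary[OF covariate treatment treatment_binary, OF assms assms])
  \<comment> \<open>The propensity score agrees with the chosen version of E[W | X] only almost
    everywhere, which suffices under the integral.\<close>
  also have "\<dots> = (\<integral>\<omega>. p g (X \<omega>) * (1 - p g (X \<omega>)) \<partial>M)"
    by (rule integral_cong_AE) (use p_eq in auto)
  finally have "(\<integral>\<omega>. cond_var_given M X (W g) \<omega> \<partial>M) \<noteq> 0"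
    using overlap[OF assms] by simp
  \<comment> \<open>The constant divisor leaves the integral and cancels; were it 0, division by
    zero would make the weight 0.\<close>
  then show ?thesis
    by (simp add: regression_weight_def)
qed

theorem mainTheorem2:
  fixes M :: "'w measure"
    and X :: "'w \<Rightarrow> real ^ 'd"
    and G :: "'g set" and c g :: 'g
    and W Y :: "'g \<Rightarrow> 'w \<Rightarrow> real"
    and p \<tau> :: "'g \<Rightarrow> real ^ 'd \<Rightarrow> real"
  assumes "treatment_model M X G c W Y p \<tau>"
    and "g \<in> G"
  shows "WATE M X (W g) (\<tau> g) =
    ATE M X (\<tau> g) + covariance M (\<lambda>\<omega>. \<tau> g (X \<omega>)) (regression_weight M X (W g))"
  \<comment> \<open>With E[\<gamma>] = 1 the product of means is the ATE and cancels;
    E[\<gamma> \<tau>] remains on both sides as the same integral up to the order of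
    factors.\<close>
  using treatment_model.integral_regression_weight[OF assms]
  by (simp add: WATE_def ATE_def covariance_def mult.commute)

end
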